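(* Let $M_0\in\widetilde{\mathcal Q}_n^{(r_0)}$, $M_1\in\widetilde{\mathcal Q}_n^{(r_1)}$ and $M_2\in\widetilde{\mathcal Q}_m^{(r_2)}$. Then: (i) $\begin{pmatrix}M_1&0\\0&M_2\end{pmatrix}\in\widetilde{\mathcal Q}_{n+m}^{(r_1+r_2)}$; (ii) $M_0+M_1\in\widetilde{\mathcal Q}_n^{(r_0+r_1)}$.
   Context: $\mathbb N=\{0,1,2,\dots\}$. $\mathcal S^n$ is the space of real symmetric $n\times n$ matrices. For $\beta\in\mathbb N^n$ put $|\beta|=\sum_i\beta_i$ and $x^\beta=x_1^{\beta_1}\cdots x_n^{\beta_n}$. For $n,r\in\mathbb N$: $\mathcal N_{n,r}$ is the set of homogeneous polynomials of degree $r$ in $x_1,\dots,x_n$ with nonnegative coefficients (including $0$); $\mathcal H_{n,r}$ is the cone of homogeneous polynomials of degree $r+2$ (including $0$) of the form $\sum_{\beta\in\mathbb N^n,\ |\beta|\in\{r,r+2\}}x^\beta\sigma_\beta$, where each $\sigma_\beta$ is a sum of squares of real polynomials of degree at most $r+2-|\beta|$. $\|p\|_1$ is the sum of the absolute values of the coefficients of $p$. Define $$\widetilde{\mathcal Q}_n^{(r)}=\{M\in\mathcal S^n:\ p\cdot x^TMx\in\mathcal H_{n,r}\text{ for some }p\in\mathcal N_{n,r}\text{ with }\|p\|_1=1\}.$$ *)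

theory Defs
  imports "HOL-Library.Poly_Mapping" "Jordan_Normal_Form.Matrix"
begin

text \<open>
  A multi-index is a finitely supported function \<open>nat \<Rightarrow> nat\<close>, and a real polynomial is a finitely
  supported function from multi-indices to coefficients; multiplication of polynomials is the
  convolution product of \<^theory>\<open>HOL-Library.Poly_Mapping\<close>.  The variables are numbered from 0, so
  \<open>\<nat>\<^sup>n\<close> is the set of multi-indices supported in \<open>{..<n}\<close>.
\<close>

type_synonym multi_index = "nat \<Rightarrow>\<^sub>0 nat"
type_synonym rpoly = "multi_index \<Rightarrow>\<^sub>0 real"

definition multi_indices :: "nat \<Rightarrow> multi_index set" where
  "multi_indices n = {\<beta>. Poly_Mapping.keys \<beta> \<subseteq> {..<n}}"

definition mdeg :: "multi_index \<Rightarrow> nat" where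
  "mdeg \<beta> = (\<Sum>i\<in>Poly_Mapping.keys \<beta>. Poly_Mapping.lookup \<beta> i)"

definition polys :: "nat \<Rightarrow> rpoly set" where
  "polys n = {p. Poly_Mapping.keys p \<subseteq> multi_indices n}"

definition xpow :: "multi_index \<Rightarrow> rpoly" where
  "xpow \<beta> = Poly_Mapping.single \<beta> 1"

definition xvar :: "nat \<Rightarrow> rpoly" where
  "xvar i = xpow (Poly_Mapping.single i 1)"

definition const_poly :: "real \<Rightarrow> rpoly" where
  "const_poly c = Poly_Mapping.single 0 c"

text \<open>Both of the following predicates hold for the zero polynomial.\<close>

definition deg_le :: "nat \<Rightarrow> rpoly \<Rightarrow> bool" where
  "deg_le d p \<longleftrightarrow> (\<forall>\<beta>\<in>Poly_Mapping.keys p. mdeg \<beta> \<le> d)"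

definition homogeneous :: "nat \<Rightarrow> rpoly \<Rightarrow> bool" where
  "homogeneous d p \<longleftrightarrow> (\<forall>\<beta>\<in>Poly_Mapping.keys p. mdeg \<beta> = d)"

definition norm1 :: "rpoly \<Rightarrow> real" where
  "norm1 p = (\<Sum>\<beta>\<in>Poly_Mapping.keys p. \<bar>Poly_Mapping.lookup p \<beta>\<bar>)"

definition N_set :: "nat \<Rightarrow> nat \<Rightarrow> rpoly set" where
  "N_set n r = {p \<in> polys n. homogeneous r p \<and> (\<forall>\<beta>. Poly_Mapping.lookup p \<beta> \<ge> 0)}"

text \<open>
  The bound \<open>d\<close> is on the degree of the polynomials being squared.  Bounding the degree of the sum
  of squares instead gives the same set \<open>H_set\<close> below: as \<open>H_set\<close> contains only
  homogeneous polynomials of degree \<open>r + 2\<close>, for \<open>|\<beta>| = r\<close> the constant and the quadratic parts of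
  the squared polynomials have to vanish.
\<close>

definition sos :: "nat \<Rightarrow> nat \<Rightarrow> rpoly set" where
  "sos n d = {s. \<exists>qs. (\<forall>q\<in>set qs. q \<in> polys n \<and> deg_le d q) \<and> s = (\<Sum>q\<leftarrow>qs. q ^ 2)}"

definition H_indices :: "nat \<Rightarrow> nat \<Rightarrow> multi_index set" where
  "H_indices n r = {\<beta> \<in> multi_indices n. mdeg \<beta> \<in> {r, r + 2}}"

text \<open>The sum in the definition of \<open>H_set\<close> ranges over a finite set.\<close>

lemma finite_H_indices: "finite (H_indices n r)"
proof -
  let ?F = "{f :: nat \<Rightarrow> nat. \<forall>i. (i \<in> {..<n} \<longrightarrow> f i \<in> {..r + 2}) \<and> (i \<notin> {..<n} \<longrightarrow> f i = 0)}"
  have "Poly_Mapping.lookup \<beta> \<in> ?F" if "\<beta> \<in> H_indices n r" for \<beta>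
  proof -
    have k: "Poly_Mapping.keys \<beta> \<subseteq> {..<n}" and d: "mdeg \<beta> \<le> r + 2"
      using that by (auto simp: H_indices_def multi_indices_def)
    have "Poly_Mapping.lookup \<beta> i \<le> r + 2" for i
    proof (cases "i \<in> Poly_Mapping.keys \<beta>")
      case True
      then have "Poly_Mapping.lookup \<beta> i \<le> mdeg \<beta>"
        unfolding mdeg_def by (intro member_le_sum) auto
      with d show ?thesis by simp
    qed (simp add: in_keys_iff)
    moreover have "Poly_Mapping.lookup \<beta> i = 0" if "i \<notin> {..<n}" for i
      using that k by (auto simp: in_keys_iff)
    ultimately show ?thesis by auto
  qed
  then have "Poly_Mapping.lookup ` H_indices n r \<subseteq> ?F" by (rule image_subsetI)
  moreover have "finite ?F" by (rule finite_set_of_finite_funs) auto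
  ultimately have "finite (Poly_Mapping.lookup ` H_indices n r)" by (rule finite_subset)
  then show ?thesis by (rule finite_imageD) (auto intro: inj_onI poly_mapping_eqI)
qed

definition H_set :: "nat \<Rightarrow> nat \<Rightarrow> rpoly set" where
  "H_set n r = {h \<in> polys n. homogeneous (r + 2) h \<and>
     (\<exists>\<sigma>. (\<forall>\<beta>\<in>H_indices n r. \<sigma> \<beta> \<in> sos n (r + 2 - mdeg \<beta>)) \<and>
          h = (\<Sum>\<beta>\<in>H_indices n r. xpow \<beta> * \<sigma> \<beta>))}"

definition sym_mats :: "nat \<Rightarrow> real mat set" where
  "sym_mats n = {M \<in> carrier_mat n n. transpose_mat M = M}"

definition qform :: "nat \<Rightarrow> real mat \<Rightarrow> rpoly" where
  "qform n M = (\<Sum>i<n. \<Sum>j<n. const_poly (M $$ (i, j)) * xvar i * xvar j)"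

definition Q_tilde :: "nat \<Rightarrow> nat \<Rightarrow> real mat set" where
  "Q_tilde n r = {M \<in> sym_mats n. \<exists>p \<in> N_set n r. norm1 p = 1 \<and> p * qform n M \<in> H_set n r}"

end

theory Submission
  imports Defs
begin

text \<open>
  Both parts rest on one computation.  If \<open>p\<close> and \<open>q\<close> are multipliers certifying that the quadratic
  forms \<open>a\<close> and \<open>b\<close> are of the required kind, then \<open>p * q\<close> is a multiplier for \<open>a + b\<close>, because
  \<open>(p * q) * (a + b) = q * (p * a) + p * (q * b)\<close>.  Three facts make this work.  The sets \<open>H_set\<close>
  are closed under addition.  Multiplying a member of \<open>H_set n r\<close> by a polynomial of \<open>N_set n s\<close>
  gives a member of \<open>H_set n (r + s)\<close> (\<open>H_set_mult\<close>): each monomial of the multiplier raises the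
  index \<open>\<beta>\<close> of a summand \<open>x\<^sup>\<beta> \<sigma>\<^sub>\<beta>\<close> by a multi-index of degree \<open>s\<close>, which leaves the degree bound
  on \<open>\<sigma>\<^sub>\<beta>\<close> unchanged, and its nonnegative coefficient is absorbed into the sum of squares.  Finally,
  the 1-norm is multiplicative on polynomials with nonnegative coefficients
  (\<open>norm1_mult_nonneg\<close>), since there it is evaluation at the point \<open>(1, \<dots>, 1)\<close>.

  For the block matrix, the form of \<open>M2\<close> and its multiplier are first moved to the variables
  \<open>x\<^sub>n, \<dots>, x\<^sub>n\<^sub>+\<^sub>m\<^sub>-\<^sub>1\<close>.  Renaming variables is a ring homomorphism that respects degrees,
  nonnegativity and the 1-norm, so it preserves all the sets involved; the form of the block matrix
  is then the sum of the form of \<open>M1\<close> and the renamed form of \<open>M2\<close>.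
\<close>

section \<open>Relabelling the keys of a finitely supported function\<close>

text \<open>
  Several constructions below are instances of this one.  Applied to a multi-index it renumbers the
  variables; applied to a polynomial, with an additive \<open>f\<close>, it is the ring homomorphism induced by
  \<open>f\<close>; and with constant \<open>f\<close> it adds up all the values, which gives the degree of a multi-index and
  the value of a polynomial at \<open>(1, \<dots>, 1)\<close>.
\<close>

definition push_forward ::
  "('a \<Rightarrow> 'b) \<Rightarrow> ('a \<Rightarrow>\<^sub>0 'c::comm_monoid_add) \<Rightarrow> ('b \<Rightarrow>\<^sub>0 'c)" where
  "push_forward f p =
     (\<Sum>k\<in>Poly_Mapping.keys p. Poly_Mapping.single (f k) (Poly_Mapping.lookup p k))"

lemma push_forward_superset:
  assumes "finite A" "Poly_Mapping.keys p \<subseteq> A"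
  shows "push_forward f p = (\<Sum>k\<in>A. Poly_Mapping.single (f k) (Poly_Mapping.lookup p k))"
  unfolding push_forward_def using assms
  by (intro sum.mono_neutral_left) (auto simp: in_keys_iff)

lemma push_forward_zero [simp]: "push_forward f 0 = 0"
  by (simp add: push_forward_def)

lemma push_forward_single [simp]:
  "push_forward f (Poly_Mapping.single k c) = Poly_Mapping.single (f k) c"
  by (subst push_forward_superset[of "{k}"]) auto

lemma push_forward_add: "push_forward f (p + q) = push_forward f p + push_forward f q"
proof -
  let ?A = "Poly_Mapping.keys p \<union> Poly_Mapping.keys q"
  have "Poly_Mapping.keys (p + q) \<subseteq> ?A"
    by (rule Poly_Mapping.keys_add)
  then show ?thesis
    by (simp add: push_forward_superset[of ?A] lookup_add single_add sum.distrib)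
qed

lemma push_forward_sum: "push_forward f (sum g A) = (\<Sum>a\<in>A. push_forward f (g a))"
  by (induction A rule: infinite_finite_induct) (simp_all add: push_forward_add)

lemma push_forward_sum_list:
  "push_forward f (sum_list ps) = (\<Sum>p\<leftarrow>ps. push_forward f p)"
  by (induction ps) (simp_all add: push_forward_add)

lemma push_forward_push_forward:
  "push_forward f (push_forward g p) = push_forward (\<lambda>k. f (g k)) p"
  by (simp add: push_forward_def[of g] push_forward_sum) (simp add: push_forward_def)

lemma push_forward_id [simp]: "push_forward (\<lambda>k. k) p = p"
proof (rule poly_mapping_eqI)
  fix k
  show "Poly_Mapping.lookup (push_forward (\<lambda>k. k) p) k = Poly_Mapping.lookup p k"
    by (auto simp: push_forward_def lookup_sum lookup_single when_def sum.delta' in_keys_iff)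
qed

lemma keys_push_forward: "Poly_Mapping.keys (push_forward f p) \<subseteq> f ` Poly_Mapping.keys p"
  using keys_sum[of "\<lambda>k. Poly_Mapping.single (f k) (Poly_Mapping.lookup p k)"
      "Poly_Mapping.keys p"]
  by (auto simp: push_forward_def split: if_splits)

lemma lookup_push_forward_nonneg:
  fixes p :: "'a \<Rightarrow>\<^sub>0 real"
  assumes "\<And>k. Poly_Mapping.lookup p k \<ge> 0"
  shows "Poly_Mapping.lookup (push_forward f p) l \<ge> 0"
  unfolding push_forward_def lookup_sum lookup_single
  by (intro sum_nonneg) (simp add: assms when_def)

lemma mult_eq_sum_single:
  fixes p q :: "'a::monoid_add \<Rightarrow>\<^sub>0 'c::semiring_0"
  shows "p * q = (\<Sum>k\<in>Poly_Mapping.keys p. \<Sum>l\<in>Poly_Mapping.keys q.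
           Poly_Mapping.single (k + l) (Poly_Mapping.lookup p k * Poly_Mapping.lookup q l))"
proof -
  have "p * q = push_forward (\<lambda>k. k) p * push_forward (\<lambda>k. k) q"
    by simp
  then show ?thesis
    by (simp only: push_forward_def sum_product mult_single)
qed

lemma push_forward_mult:
  fixes f :: "'a::monoid_add \<Rightarrow> 'b::monoid_add" and p q :: "'a \<Rightarrow>\<^sub>0 'c::semiring_0"
  assumes "\<And>k l. f (k + l) = f k + f l"
  shows "push_forward f (p * q) = push_forward f p * push_forward f q"
  unfolding mult_eq_sum_single[of p q]
  by (simp add: push_forward_sum assms)
    (simp only: push_forward_def sum_product mult_single)

lemma lookup_mult_nonneg:
  fixes p q :: "'a::monoid_add \<Rightarrow>\<^sub>0 real"
  assumes "\<And>k. Poly_Mapping.lookup p k \<ge> 0" "\<And>k. Poly_Mapping.lookup q k \<ge> 0"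
  shows "Poly_Mapping.lookup (p * q) k \<ge> 0"
  unfolding mult_eq_sum_single[of p q] lookup_sum lookup_single
  by (intro sum_nonneg) (simp add: assms when_def)

section \<open>Degrees and the 1-norm\<close>

lemma push_forward_const_eq_mdeg:
  "push_forward (\<lambda>_. 0 :: nat) \<beta> = Poly_Mapping.single 0 (mdeg \<beta>)"
  by (rule poly_mapping_eqI)
    (simp add: push_forward_def mdeg_def lookup_sum lookup_single when_def)

lemma mdeg_add: "mdeg (\<beta> + \<gamma>) = mdeg \<beta> + mdeg \<gamma>"
proof -
  have "Poly_Mapping.single (0 :: nat) (mdeg (\<beta> + \<gamma>)) = Poly_Mapping.single 0 (mdeg \<beta> + mdeg \<gamma>)"
    by (simp add: push_forward_const_eq_mdeg[symmetric] push_forward_add single_add)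
  then show ?thesis
    by (metis lookup_single_eq)
qed

lemma mdeg_push_forward [simp]: "mdeg (push_forward f \<beta>) = mdeg \<beta>"
proof -
  have "Poly_Mapping.single (0 :: nat) (mdeg (push_forward f \<beta>)) = Poly_Mapping.single 0 (mdeg \<beta>)"
    by (simp add: push_forward_const_eq_mdeg[symmetric] push_forward_push_forward)
  then show ?thesis
    by (metis lookup_single_eq)
qed

lemma push_forward_const_eq_norm1:
  assumes "\<And>\<beta>. Poly_Mapping.lookup p \<beta> \<ge> 0"
  shows "push_forward (\<lambda>_. 0 :: nat) p = Poly_Mapping.single 0 (norm1 p)"
  by (rule poly_mapping_eqI)
    (simp add: push_forward_def norm1_def lookup_sum lookup_single when_def assms)

text \<open>
  Collapsing all keys to \<open>0\<close> is a ring homomorphism, and on nonnegative polynomials it computes the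
  1-norm because the absolute values can be dropped.
\<close>

lemma norm1_mult_nonneg:
  assumes "\<And>\<beta>. Poly_Mapping.lookup p \<beta> \<ge> 0" "\<And>\<beta>. Poly_Mapping.lookup q \<beta> \<ge> 0"
  shows "norm1 (p * q) = norm1 p * norm1 q"
proof -
  have "Poly_Mapping.single (0 :: nat) (norm1 (p * q)) = push_forward (\<lambda>_. 0) (p * q)"
    using assms by (simp add: push_forward_const_eq_norm1 lookup_mult_nonneg)
  also have "\<dots> = push_forward (\<lambda>_. 0) p * push_forward (\<lambda>_. 0) q"
    by (rule push_forward_mult) simp
  also have "\<dots> = Poly_Mapping.single 0 (norm1 p * norm1 q)"
    using assms by (simp add: push_forward_const_eq_norm1 mult_single)
  finally show ?thesis
    by (metis lookup_single_eq)
qed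

lemma norm1_push_forward_nonneg:
  assumes "\<And>\<beta>. Poly_Mapping.lookup p \<beta> \<ge> 0"
  shows "norm1 (push_forward f p) = norm1 p"
proof -
  have "Poly_Mapping.single (0 :: nat) (norm1 (push_forward f p)) = Poly_Mapping.single 0 (norm1 p)"
    using assms
    by (simp add: push_forward_const_eq_norm1[symmetric] lookup_push_forward_nonneg
        push_forward_push_forward)
  then show ?thesis
    by (metis lookup_single_eq)
qed

section \<open>Closure properties of the sets of polynomials\<close>

lemma multi_indices_add:
  "\<beta> \<in> multi_indices n \<Longrightarrow> \<gamma> \<in> multi_indices n \<Longrightarrow> \<beta> + \<gamma> \<in> multi_indices n"
  using Poly_Mapping.keys_add[of \<beta> \<gamma>] by (auto simp: multi_indices_def)

lemma polys_add: "p \<in> polys n \<Longrightarrow> q \<in> polys n \<Longrightarrow> p + q \<in> polys n"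
  using Poly_Mapping.keys_add[of p q] by (auto simp: polys_def)

lemma polys_mult: "p \<in> polys n \<Longrightarrow> q \<in> polys n \<Longrightarrow> p * q \<in> polys n"
  using keys_mult[of p q] by (fastforce simp: polys_def intro: multi_indices_add)

lemma homogeneous_add: "homogeneous d p \<Longrightarrow> homogeneous d q \<Longrightarrow> homogeneous d (p + q)"
  using Poly_Mapping.keys_add[of p q] by (auto simp: homogeneous_def)

lemma homogeneous_mult:
  "homogeneous d p \<Longrightarrow> homogeneous e q \<Longrightarrow> homogeneous (d + e) (p * q)"
  using keys_mult[of p q] by (fastforce simp: homogeneous_def mdeg_add)

lemma N_set_mult:
  "p \<in> N_set n r \<Longrightarrow> q \<in> N_set n s \<Longrightarrow> p * q \<in> N_set n (r + s)"
  by (simp add: N_set_def polys_mult homogeneous_mult lookup_mult_nonneg)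

lemma sos_zero: "0 \<in> sos n d"
  unfolding sos_def by (intro CollectI exI[of _ "[]"]) simp

lemma sos_add:
  assumes "s \<in> sos n d" "t \<in> sos n d"
  shows "s + t \<in> sos n d"
proof -
  obtain ps qs where "\<forall>q\<in>set ps. q \<in> polys n \<and> deg_le d q" "s = (\<Sum>q\<leftarrow>ps. q ^ 2)"
    and "\<forall>q\<in>set qs. q \<in> polys n \<and> deg_le d q" "t = (\<Sum>q\<leftarrow>qs. q ^ 2)"
    using assms by (auto simp: sos_def)
  then show ?thesis
    unfolding sos_def by (intro CollectI exI[of _ "ps @ qs"]) auto
qed

lemma keys_const_poly_mult:
  "Poly_Mapping.keys (const_poly c * p) \<subseteq> Poly_Mapping.keys p"
  using keys_mult[of "const_poly c" p] by (auto simp: const_poly_def split: if_splits)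

text \<open>The nonnegative factor enters each square through its square root.\<close>

lemma sos_const_mult:
  assumes "c \<ge> 0" "s \<in> sos n d"
  shows "const_poly c * s \<in> sos n d"
proof -
  obtain qs where qs: "\<forall>q\<in>set qs. q \<in> polys n \<and> deg_le d q" "s = (\<Sum>q\<leftarrow>qs. q ^ 2)"
    using assms by (auto simp: sos_def)
  let ?c = "const_poly (sqrt c)"
  have "const_poly c = ?c ^ 2"
    using assms(1) by (simp add: const_poly_def power2_eq_square mult_single)
  then have "const_poly c * s = (\<Sum>q\<leftarrow>map ((*) ?c) qs. q ^ 2)"
    by (simp add: qs(2) sum_list_const_mult[symmetric] power_mult_distrib o_def)
  moreover have "\<forall>q\<in>set (map ((*) ?c) qs). q \<in> polys n \<and> deg_le d q"
    using qs(1) keys_const_poly_mult by (fastforce simp: polys_def deg_le_def)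
  ultimately show ?thesis
    unfolding sos_def by blast
qed

text \<open>
  The cone of sums \<open>\<Sum>x\<^sup>\<beta> \<sigma>\<^sub>\<beta>\<close> without the requirement of homogeneity.  It contains every single
  summand, which \<open>H_set\<close> does not, so its closure properties can be checked one summand at a time.
\<close>

definition H_sums :: "nat \<Rightarrow> nat \<Rightarrow> rpoly set" where
  "H_sums n r = {h. \<exists>\<sigma>. (\<forall>\<beta>\<in>H_indices n r. \<sigma> \<beta> \<in> sos n (r + 2 - mdeg \<beta>)) \<and>
     h = (\<Sum>\<beta>\<in>H_indices n r. xpow \<beta> * \<sigma> \<beta>)}"

lemma H_set_eq: "H_set n r = {h \<in> polys n. homogeneous (r + 2) h \<and> h \<in> H_sums n r}"
  by (simp add: H_set_def H_sums_def)

lemma H_sums_zero: "0 \<in> H_sums n r"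
  unfolding H_sums_def by (intro CollectI exI[of _ "\<lambda>_. 0"]) (simp add: sos_zero)

lemma H_sums_add:
  assumes "g \<in> H_sums n r" "h \<in> H_sums n r"
  shows "g + h \<in> H_sums n r"
proof -
  obtain \<sigma> \<tau> where "\<forall>\<beta>\<in>H_indices n r. \<sigma> \<beta> \<in> sos n (r + 2 - mdeg \<beta>)"
    "g = (\<Sum>\<beta>\<in>H_indices n r. xpow \<beta> * \<sigma> \<beta>)"
    and "\<forall>\<beta>\<in>H_indices n r. \<tau> \<beta> \<in> sos n (r + 2 - mdeg \<beta>)"
    "h = (\<Sum>\<beta>\<in>H_indices n r. xpow \<beta> * \<tau> \<beta>)"
    using assms by (auto simp: H_sums_def)
  then show ?thesis
    unfolding H_sums_def
    by (intro CollectI exI[of _ "\<lambda>\<beta>. \<sigma> \<beta> + \<tau> \<beta>"])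
      (simp add: sos_add sum.distrib distrib_left)
qed

lemma H_sums_sum: "(\<And>a. a \<in> A \<Longrightarrow> g a \<in> H_sums n r) \<Longrightarrow> sum g A \<in> H_sums n r"
  by (induction A rule: infinite_finite_induct) (simp_all add: H_sums_zero H_sums_add)

lemma H_sums_term:
  assumes "\<beta> \<in> H_indices n r" "s \<in> sos n (r + 2 - mdeg \<beta>)"
  shows "xpow \<beta> * s \<in> H_sums n r"
  unfolding H_sums_def using assms
  by (intro CollectI exI[of _ "\<lambda>\<gamma>. if \<gamma> = \<beta> then s else 0"])
    (auto simp: sos_zero finite_H_indices if_distrib[of "(*) _"] cong: if_cong)

text \<open>
  Expanding \<open>p\<close> into monomials \<open>c x\<^sup>\<gamma>\<close>, the product with \<open>x\<^sup>\<beta> \<sigma>\<^sub>\<beta>\<close> is the summand with index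
  \<open>\<gamma> + \<beta>\<close> and sum of squares \<open>c \<sigma>\<^sub>\<beta>\<close>.  Different pairs can give the same index, which is why
  closure under addition is used instead of exhibiting the new sums of squares.
\<close>

lemma H_sums_mult:
  assumes p: "p \<in> N_set n s" and h: "h \<in> H_sums n r"
  shows "p * h \<in> H_sums n (r + s)"
proof -
  obtain \<sigma> where \<sigma>: "\<And>\<beta>. \<beta> \<in> H_indices n r \<Longrightarrow> \<sigma> \<beta> \<in> sos n (r + 2 - mdeg \<beta>)"
    and h_eq: "h = (\<Sum>\<beta>\<in>H_indices n r. xpow \<beta> * \<sigma> \<beta>)"
    using h by (auto simp: H_sums_def)
  have "Poly_Mapping.single \<gamma> (Poly_Mapping.lookup p \<gamma>) * (xpow \<beta> * \<sigma> \<beta>) \<in> H_sums n (r + s)"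
    if \<gamma>: "\<gamma> \<in> Poly_Mapping.keys p" and \<beta>: "\<beta> \<in> H_indices n r" for \<gamma> \<beta>
  proof -
    let ?c = "Poly_Mapping.lookup p \<gamma>"
    have deg: "mdeg \<gamma> = s" and \<gamma>_in: "\<gamma> \<in> multi_indices n" and c: "?c \<ge> 0"
      using p \<gamma> by (auto simp: N_set_def homogeneous_def polys_def)
    have "\<gamma> + \<beta> \<in> H_indices n (r + s)"
      using \<beta> \<gamma>_in deg by (auto simp: H_indices_def mdeg_add multi_indices_add)
    moreover have "const_poly ?c * \<sigma> \<beta> \<in> sos n (r + s + 2 - mdeg (\<gamma> + \<beta>))"
      using sos_const_mult[OF c \<sigma>[OF \<beta>]] by (simp add: mdeg_add deg)
    ultimately have "xpow (\<gamma> + \<beta>) * (const_poly ?c * \<sigma> \<beta>) \<in> H_sums n (r + s)"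
      by (rule H_sums_term)
    moreover have "Poly_Mapping.single \<gamma> ?c * xpow \<beta> = xpow (\<gamma> + \<beta>) * const_poly ?c"
      by (simp add: xpow_def const_poly_def mult_single)
    ultimately show ?thesis
      by (simp add: mult.assoc[symmetric])
  qed
  then have "push_forward (\<lambda>\<gamma>. \<gamma>) p * h \<in> H_sums n (r + s)"
    unfolding push_forward_def h_eq sum_product by (intro H_sums_sum)
  then show ?thesis
    by simp
qed

lemma H_set_add: "g \<in> H_set n r \<Longrightarrow> h \<in> H_set n r \<Longrightarrow> g + h \<in> H_set n r"
  by (simp add: H_set_eq polys_add homogeneous_add H_sums_add)

lemma H_set_mult:
  assumes "p \<in> N_set n s" "h \<in> H_set n r"
  shows "p * h \<in> H_set n (r + s)"
proof -
  have "homogeneous s p" "homogeneous (r + 2) h"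
    using assms by (simp_all add: H_set_eq N_set_def)
  then have "homogeneous (s + (r + 2)) (p * h)"
    by (rule homogeneous_mult)
  moreover have "p * h \<in> polys n"
    using assms by (auto simp: H_set_eq N_set_def intro: polys_mult)
  ultimately show ?thesis
    using H_sums_mult[OF assms(1), of h r] assms(2) by (simp add: H_set_eq add.commute)
qed

section \<open>Renaming variables\<close>

text \<open>
  The inner relabelling moves the exponent of variable number \<open>i\<close> to number \<open>f i\<close>, adding exponents
  where \<open>f\<close> identifies variables.  It is additive, so the outer relabelling is the substitution
  homomorphism sending \<open>xvar i\<close> to \<open>xvar (f i)\<close>.
\<close>

abbreviation rename :: "(nat \<Rightarrow> nat) \<Rightarrow> rpoly \<Rightarrow> rpoly" where
  "rename f \<equiv> push_forward (push_forward f)"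

lemma rename_id [simp]: "rename (\<lambda>i. i) p = p"
proof -
  have "push_forward (\<lambda>i. i) = (\<lambda>\<beta> :: multi_index. \<beta>)"
    by (rule ext) simp
  then show ?thesis
    by simp
qed

lemma rename_mult: "rename f (p * q) = rename f p * rename f q"
  by (rule push_forward_mult) (rule push_forward_add)

lemma rename_xpow: "rename f (xpow \<beta>) = xpow (push_forward f \<beta>)"
  by (simp add: xpow_def)

lemma rename_qform:
  "rename f (qform n M) = (\<Sum>i<n. \<Sum>j<n. const_poly (M $$ (i, j)) * xvar (f i) * xvar (f j))"
  by (simp add: qform_def push_forward_sum rename_mult const_poly_def xvar_def xpow_def)

lemma push_forward_multi_indices:
  assumes "f ` {..<m} \<subseteq> {..<n}" "\<beta> \<in> multi_indices m"
  shows "push_forward f \<beta> \<in> multi_indices n"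
  using assms keys_push_forward[of f \<beta>] by (fastforce simp: multi_indices_def)

lemma rename_polys:
  assumes "f ` {..<m} \<subseteq> {..<n}" "p \<in> polys m"
  shows "rename f p \<in> polys n"
  using assms keys_push_forward[of "push_forward f" p] push_forward_multi_indices[OF assms(1)]
  by (fastforce simp: polys_def)

lemma rename_homogeneous: "homogeneous d p \<Longrightarrow> homogeneous d (rename f p)"
  using keys_push_forward[of "push_forward f" p] by (fastforce simp: homogeneous_def)

lemma rename_deg_le: "deg_le d p \<Longrightarrow> deg_le d (rename f p)"
  using keys_push_forward[of "push_forward f" p] by (fastforce simp: deg_le_def)

lemma rename_N_set:
  assumes "f ` {..<m} \<subseteq> {..<n}" "p \<in> N_set m r"
  shows "rename f p \<in> N_set n r"
  using assms
  by (simp add: N_set_def rename_polys rename_homogeneous lookup_push_forward_nonneg)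

lemma rename_sos:
  assumes "f ` {..<m} \<subseteq> {..<n}" "s \<in> sos m d"
  shows "rename f s \<in> sos n d"
proof -
  obtain qs where qs: "\<forall>q\<in>set qs. q \<in> polys m \<and> deg_le d q" "s = (\<Sum>q\<leftarrow>qs. q ^ 2)"
    using assms by (auto simp: sos_def)
  have "rename f s = (\<Sum>q\<leftarrow>map (rename f) qs. q ^ 2)"
    by (simp add: qs(2) push_forward_sum_list rename_mult power2_eq_square o_def)
  moreover have "\<forall>q\<in>set (map (rename f) qs). q \<in> polys n \<and> deg_le d q"
    using qs(1) by (auto intro: rename_polys[OF assms(1)] rename_deg_le)
  ultimately show ?thesis
    unfolding sos_def by blast
qed

lemma rename_H_set:
  assumes f: "f ` {..<m} \<subseteq> {..<n}" and h: "h \<in> H_set m r"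
  shows "rename f h \<in> H_set n r"
proof -
  obtain \<sigma> where \<sigma>: "\<And>\<beta>. \<beta> \<in> H_indices m r \<Longrightarrow> \<sigma> \<beta> \<in> sos m (r + 2 - mdeg \<beta>)"
    and h_eq: "h = (\<Sum>\<beta>\<in>H_indices m r. xpow \<beta> * \<sigma> \<beta>)"
    using h by (auto simp: H_set_def)
  have "xpow (push_forward f \<beta>) * rename f (\<sigma> \<beta>) \<in> H_sums n r" if "\<beta> \<in> H_indices m r" for \<beta>
    using that rename_sos[OF f \<sigma>[OF that]] push_forward_multi_indices[OF f]
    by (intro H_sums_term) (auto simp: H_indices_def)
  then have "rename f h \<in> H_sums n r"
    unfolding h_eq push_forward_sum rename_mult rename_xpow by (intro H_sums_sum)
  then show ?thesis
    using h by (simp add: H_set_eq rename_polys[OF f] rename_homogeneous)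
qed

section \<open>Sums and block sums of matrices\<close>

text \<open>
  The product of the multipliers works: each summand of \<open>p * q * (a + b)\<close> is one of the two given
  certificates times the multiplier of the other form.
\<close>

lemma multipliers_combine:
  assumes p: "p \<in> N_set n r" "norm1 p = 1" "p * a \<in> H_set n r"
    and q: "q \<in> N_set n s" "norm1 q = 1" "q * b \<in> H_set n s"
  shows "\<exists>t \<in> N_set n (r + s). norm1 t = 1 \<and> t * (a + b) \<in> H_set n (r + s)"
proof (intro bexI conjI)
  show "p * q \<in> N_set n (r + s)"
    using p(1) q(1) by (rule N_set_mult)
  show "norm1 (p * q) = 1"
    using p q by (simp add: norm1_mult_nonneg N_set_def)
  have "q * (p * a) + p * (q * b) \<in> H_set n (r + s)"
    using H_set_mult[OF q(1) p(3)] H_set_mult[OF p(1) q(3)]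
    by (intro H_set_add) (simp_all add: add.commute)
  then show "p * q * (a + b) \<in> H_set n (r + s)"
    by (simp add: algebra_simps)
qed

lemma qform_add:
  assumes "M \<in> carrier_mat n n" "M' \<in> carrier_mat n n"
  shows "qform n (M + M') = qform n M + qform n M'"
  using assms
  by (simp add: qform_def const_poly_def single_add distrib_right sum.distrib)

lemma sum_lessThan_add:
  fixes g :: "nat \<Rightarrow> 'a::comm_monoid_add"
  shows "sum g {..<n + m} = sum g {..<n} + (\<Sum>i<m. g (n + i))"
  by (induction m) (simp_all add: add.assoc)

text \<open>
  The off-diagonal blocks of the index square contribute zero, and the lower right block is the form
  of \<open>M'\<close> in the variables numbered from \<open>n\<close>.
\<close>

lemma qform_block_diag:
  assumes "M \<in> carrier_mat n n" "M' \<in> carrier_mat m m"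
  shows "qform (n + m) (four_block_mat M (0\<^sub>m n m) (0\<^sub>m m n) M') =
    qform n M + rename ((+) n) (qform m M')"
  using assms
  unfolding rename_qform
  by (simp add: qform_def sum_lessThan_add const_poly_def)

theorem lemma3p1:
  fixes n m r0 r1 r2 :: nat
    and M0 M1 M2 :: "real mat"
  assumes "M0 \<in> Q_tilde n r0"
    and "M1 \<in> Q_tilde n r1"
    and "M2 \<in> Q_tilde m r2"
  shows "four_block_mat M1 (0\<^sub>m n m) (0\<^sub>m m n) M2 \<in> Q_tilde (n + m) (r1 + r2)
       \<and> M0 + M1 \<in> Q_tilde n (r0 + r1)"
proof
  have M0: "M0 \<in> carrier_mat n n" "transpose_mat M0 = M0"
    and M1: "M1 \<in> carrier_mat n n" "transpose_mat M1 = M1"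
    and M2: "M2 \<in> carrier_mat m m" "transpose_mat M2 = M2"
    using assms by (auto simp: Q_tilde_def sym_mats_def)
  obtain p0 where p0: "p0 \<in> N_set n r0" "norm1 p0 = 1" "p0 * qform n M0 \<in> H_set n r0"
    using assms(1) by (auto simp: Q_tilde_def)
  obtain p1 where p1: "p1 \<in> N_set n r1" "norm1 p1 = 1" "p1 * qform n M1 \<in> H_set n r1"
    using assms(2) by (auto simp: Q_tilde_def)
  obtain p2 where p2: "p2 \<in> N_set m r2" "norm1 p2 = 1" "p2 * qform m M2 \<in> H_set m r2"
    using assms(3) by (auto simp: Q_tilde_def)

  have "M0 + M1 \<in> sym_mats n"
    using M0 M1 by (simp add: sym_mats_def transpose_add)
  then show "M0 + M1 \<in> Q_tilde n (r0 + r1)"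
    using multipliers_combine[OF p0 p1] M0 M1 by (simp add: Q_tilde_def qform_add)

  let ?B = "four_block_mat M1 (0\<^sub>m n m) (0\<^sub>m m n) M2"
  \<comment> \<open>Renaming along the identity regards polynomials in \<open>n\<close> variables as polynomials in \<open>n + m\<close>
    variables.\<close>
  have id: "(\<lambda>i. i) ` {..<n} \<subseteq> {..<n + m}"
    by auto
  have p1': "p1 \<in> N_set (n + m) r1" "p1 * qform n M1 \<in> H_set (n + m) r1"
    using rename_N_set[OF id p1(1)] rename_H_set[OF id p1(3)] by simp_all
  have shift: "(+) n ` {..<m} \<subseteq> {..<n + m}"
    by auto
  have p2': "rename ((+) n) p2 \<in> N_set (n + m) r2"
    "rename ((+) n) p2 * rename ((+) n) (qform m M2) \<in> H_set (n + m) r2"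
    using rename_N_set[OF shift p2(1)] rename_H_set[OF shift p2(3)]
    by (simp_all add: rename_mult)
  have "norm1 (rename ((+) n) p2) = 1"
    using p2 by (simp add: norm1_push_forward_nonneg N_set_def)
  note multipliers_combine[OF p1'(1) p1(2) p1'(2) p2'(1) this p2'(2)]
  moreover have "?B \<in> sym_mats (n + m)"
    using M1 M2 transpose_four_block_mat[of M1 n n "0\<^sub>m n m" m "0\<^sub>m m n" m M2]
    by (auto simp: sym_mats_def)
  ultimately show "?B \<in> Q_tilde (n + m) (r1 + r2)"
    using M1 M2 by (simp add: Q_tilde_def qform_block_diag)
qed

end
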